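(* Let $n\ge 1$ and let $\mathbf A$ be a real $n\times n$ SJSK-matrix. Then $\mathbf A$ is a $\tau^<$-matrix; that is, $l(\mathbf A)>0$ and $l(\mathbf A(\alpha))<l(\mathbf A(\beta))<\infty$ whenever $\emptyset\neq\beta\subsetneq\alpha\subseteq[n]$.
   Context: Let $[n]=\{1,\ldots,n\}$. A real $m\times m$ matrix $\mathbf M=\{m_{ij}\}$ is strictly J-sign-symmetric (SJS) if there is a subset $J\subseteq[m]$, with complement $J^c=[m]\setminus J$, such that $m_{ij}>0$ for $(i,j)\in(J\times J)\cup(J^c\times J^c)$ and $m_{ij}<0$ for $(i,j)\in(J\times J^c)\cup(J^c\times J)$. Equivalently, $\mathbf M=\mathbf D\widetilde{\mathbf M}\mathbf D^{-1}$ with $\widetilde{\mathbf M}$ entrywise positive and $\mathbf D$ diagonal with diagonal entries $\pm1$. The $j$th compound matrix $\mathbf M^{(j)}$ is the $\binom mj\times\binom mj$ matrix of all $j\times j$ minors of $\mathbf M$, with row and column index sets (each listed increasingly) ordered lexicographically. A real $n\times n$ matrix $\mathbf A$ is strictly J-sign-symmetric Kotelyansky (SJSK) if: (1) $\det\mathbf A>0$; (2) for all $j=2,\ldots,n$ and every $j\times j$ principal submatrix $\mathbf M$ of $\mathbf A$, the $(j-1)$th compound matrix $\mathbf M^{(j-1)}$ is strictly J-sign-symmetric (the set $J$ may depend on the submatrix). For a square matrix $\mathbf M$ with spectrum $\sigma(\mathbf M)$, $l(\mathbf M):=\min(\sigma(\mathbf M)\cap\mathbb R)$, with $l(\mathbf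 M):=\infty$ if $\mathbf M$ has no real eigenvalue. For nonempty $\alpha\subseteq[n]$, $\mathbf A(\alpha)$ is the principal submatrix of $\mathbf A$ with rows and columns indexed by $\alpha$. $\mathbf A$ is a $\tau$-matrix if $l(\mathbf A)\ge0$ and $l(\mathbf A(\alpha))\le l(\mathbf A(\beta))<\infty$ whenever $\emptyset\ne\beta\subseteq\alpha\subseteq[n]$. It is a $\tau^<$-matrix (strictly $\tau$-matrix) if, in addition, $l(\mathbf A)>0$ and $l(\mathbf A(\alpha))<l(\mathbf A(\beta))$ whenever $\emptyset\ne\beta\subsetneq\alpha\subseteq[n]$. *)

theory Defs
  imports
    Jordan_Normal_Form.Spectral_Radius
    Jordan_Normal_Form.DL_Submatrix
    "HOL-Library.Extended_Real"
begin

text \<open>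
  Rows and columns are numbered from 0, so the index set \<open>[n]\<close> is \<open>{..<n}\<close>.
\<close>

text \<open>
  The \<open>j\<close>-element subsets of \<open>{..<m}\<close> as increasing lists, in lexicographic order.
  The order comes from the recursion of \<open>subseqs\<close>, which puts the sublists containing the
  head before those that do not; the three lemmas below confirm the enumeration.
\<close>

definition lex_subsets :: "nat \<Rightarrow> nat \<Rightarrow> nat list list" where
  "lex_subsets m j = filter (\<lambda>I. length I = j) (subseqs [0..<m])"

lemma sorted_wrt_lexord_subseqs:
  assumes "sorted_wrt (<) (xs :: nat list)"
  shows "sorted_wrt (\<lambda>I K. (I, K) \<in> lexord less_than) (filter (\<lambda>I. length I = j) (subseqs xs))"
  using assms
proof (induction xs arbitrary: j)
  case Nil
  then show ?case by simp
next
  case (Cons x xs)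
  have sub: "set I \<subseteq> set xs" if "I \<in> set (subseqs xs)" for I
    using that subseqs_powset[of xs] by auto
  show ?case
  proof (cases j)
    case 0
    then show ?thesis using Cons.IH[of 0] Cons.prems by (simp add: Let_def filter_map o_def)
  next
    case (Suc k)
    have cons: "sorted_wrt (\<lambda>I K. (I, K) \<in> lexord less_than)
        (map (Cons x) (filter (\<lambda>I. length I = k) (subseqs xs)))"
      using Cons by (simp add: sorted_wrt_map)
    have "(x # I, K) \<in> lexord less_than"
      if K_in: "K \<in> set (subseqs xs)" and K_len: "length K = Suc k" for I K
    proof -
      obtain y ys where K: "K = y # ys" using K_len by (cases K) auto
      then have "y \<in> set xs" using sub[OF K_in] by auto
      then have "x < y" using Cons.prems by simp
      then show ?thesis using K by simp
    qed
    with cons Cons Suc show ?thesis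
      by (auto simp: Let_def filter_map o_def sorted_wrt_append)
  qed
qed

lemma lex_subsets_sorted:
  "sorted_wrt (\<lambda>I K. (I, K) \<in> lexord less_than) (lex_subsets m j)"
  unfolding lex_subsets_def by (rule sorted_wrt_lexord_subseqs) simp

lemma lex_subsets_increasing:
  assumes "I \<in> set (lex_subsets m j)"
  shows "sorted_wrt (<) I"
proof -
  have "sorted_wrt (<) I" if "I \<in> set (subseqs xs)" "sorted_wrt (<) xs" for I xs :: "nat list"
    using that
  proof (induction xs arbitrary: I)
    case (Cons x xs)
    have sub: "set K \<subseteq> set xs" if "K \<in> set (subseqs xs)" for K
      using that subseqs_powset[of xs] by auto
    from Cons.prems consider (tail) "I \<in> set (subseqs xs)"
      | (head) K where "K \<in> set (subseqs xs)" "I = x # K"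
      by (auto simp: Let_def)
    then show ?case
    proof cases
      case tail
      then show ?thesis using Cons.IH Cons.prems(2) by simp
    next
      case head
      then show ?thesis using Cons.IH[of K] Cons.prems(2) sub[of K] by auto
    qed
  qed simp
  then show ?thesis using assms by (auto simp: lex_subsets_def)
qed

lemma bij_betw_lex_subsets:
  "bij_betw set (set (lex_subsets m j)) {S. S \<subseteq> {..<m} \<and> card S = j}"
proof (rule bij_betw_imageI)
  show "inj_on set (set (lex_subsets m j))"
    by (rule inj_onI) (rule strict_sorted_equal, auto intro: lex_subsets_increasing)
  have card: "card (set I) = length I" if "I \<in> set (subseqs [0..<m])" for I
    using that subseqs_distinctD[of I "[0..<m]"] by (simp add: distinct_card)
  have pow: "set ` set (subseqs [0..<m]) = Pow {..<m}"
    by (simp add: subseqs_powset lessThan_atLeast0)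
  show "set ` set (lex_subsets m j) = {S. S \<subseteq> {..<m} \<and> card S = j}" (is "?L = ?R")
  proof
    show "?L \<subseteq> ?R"
    proof
      fix S assume "S \<in> ?L"
      then obtain I where I: "I \<in> set (subseqs [0..<m])" "length I = j" "S = set I"
        by (auto simp: lex_subsets_def)
      then have "S \<in> Pow {..<m}" unfolding pow[symmetric] by (intro image_eqI)
      then show "S \<in> ?R" using I card by simp
    qed
    show "?R \<subseteq> ?L"
    proof
      fix S assume S: "S \<in> ?R"
      then have "S \<in> set ` set (subseqs [0..<m])" unfolding pow by simp
      then obtain I where I: "I \<in> set (subseqs [0..<m])" "S = set I" by (elim imageE)
      then have "I \<in> set (lex_subsets m j)" using S card by (simp add: lex_subsets_def)
      then show "S \<in> ?L" using I(2) by (intro image_eqI)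
    qed
  qed
qed

definition compound_matrix :: "nat \<Rightarrow> real mat \<Rightarrow> real mat" where
  "compound_matrix j M =
    (let R = lex_subsets (dim_row M) j; C = lex_subsets (dim_col M) j
     in mat (length R) (length C) (\<lambda>(a, b). det (submatrix M (set (R ! a)) (set (C ! b)))))"

definition strictly_J_sign_symmetric :: "real mat \<Rightarrow> bool" where
  "strictly_J_sign_symmetric M \<longleftrightarrow>
    square_mat M \<and>
    (\<exists>J \<subseteq> {..<dim_row M}. let J' = {..<dim_row M} - J in
      (\<forall>(i, j) \<in> (J \<times> J) \<union> (J' \<times> J'). M $$ (i, j) > 0) \<and>
      (\<forall>(i, j) \<in> (J \<times> J') \<union> (J' \<times> J). M $$ (i, j) < 0))"

definition principal_submatrix :: "real mat \<Rightarrow> nat set \<Rightarrow> real mat" where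
  "principal_submatrix A \<alpha> = submatrix A \<alpha> \<alpha>"

definition SJSK :: "real mat \<Rightarrow> bool" where
  "SJSK A \<longleftrightarrow>
    square_mat A \<and> det A > 0 \<and>
    (\<forall>j \<in> {2..dim_row A}. \<forall>\<alpha> \<subseteq> {..<dim_row A}. card \<alpha> = j \<longrightarrow>
      strictly_J_sign_symmetric (compound_matrix (j - 1) (principal_submatrix A \<alpha>)))"

text \<open>
  The spectrum is taken over the complex numbers and then intersected with the reals.
  For square matrices it is finite, so \<open>Min\<close> is the true minimum whenever it is applied.
\<close>

definition real_spectrum :: "real mat \<Rightarrow> real set" where
  "real_spectrum M = {x. complex_of_real x \<in> spectrum (map_mat complex_of_real M)}"

definition min_real_eigenvalue :: "real mat \<Rightarrow> ereal" where
  "min_real_eigenvalue M =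
    (if real_spectrum M = {} then \<infinity> else ereal (Min (real_spectrum M)))"

lemma finite_real_spectrum:
  assumes "M \<in> carrier_mat n n"
  shows "finite (real_spectrum M)"
proof -
  have "finite (spectrum (map_mat complex_of_real M))"
    using assms by (intro card_finite_spectrum(1)[where n = n]) simp
  then have "finite (complex_of_real -` spectrum (map_mat complex_of_real M))"
    by (intro finite_vimageI) (auto simp: inj_on_def)
  then show ?thesis by (simp add: real_spectrum_def vimage_def)
qed

definition tau_matrix :: "real mat \<Rightarrow> bool" where
  "tau_matrix A \<longleftrightarrow>
    square_mat A \<and> min_real_eigenvalue A \<ge> 0 \<and>
    (\<forall>\<alpha> \<beta>. \<beta> \<noteq> {} \<and> \<beta> \<subseteq> \<alpha> \<and> \<alpha> \<subseteq> {..<dim_row A} \<longrightarrow>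
      min_real_eigenvalue (principal_submatrix A \<alpha>)
        \<le> min_real_eigenvalue (principal_submatrix A \<beta>) \<and>
      min_real_eigenvalue (principal_submatrix A \<beta>) < \<infinity>)"

definition strictly_tau_matrix :: "real mat \<Rightarrow> bool" where
  "strictly_tau_matrix A \<longleftrightarrow>
    tau_matrix A \<and> min_real_eigenvalue A > 0 \<and>
    (\<forall>\<alpha> \<beta>. \<beta> \<noteq> {} \<and> \<beta> \<subset> \<alpha> \<and> \<alpha> \<subseteq> {..<dim_row A} \<longrightarrow>
      min_real_eigenvalue (principal_submatrix A \<alpha>)
        < min_real_eigenvalue (principal_submatrix A \<beta>))"

end

theory Submission
  imports Defs "HOL-Analysis.Function_Topology"
begin

text \<open>
  All principal minors of an SJSK matrix are positive, so no principal submatrix has an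
  eigenvalue \<open>\<le> 0\<close>. The inverse of each principal submatrix \<open>M\<close> is, up to conjugation by a
  signature matrix, an entrywise positive matrix \<open>Q\<close>; hence \<open>Q\<close> has a positive left eigenvector
  \<open>y\<close>, with eigenvalue \<open>r > 0\<close>, and \<open>1 / r\<close> is an eigenvalue of \<open>M\<close>. An eigenvector for
  \<open>0 < t \<le> 1 / r\<close> of \<open>M\<close> with row and column \<open>a\<close> removed, extended by \<open>v\<^sub>a = 0\<close>, satisfies
  \<open>v = t Q v + c Q e\<^sub>a\<close>, where \<open>c \<ge> 0\<close> after a change of sign. The negative part \<open>w\<close> of \<open>v\<close>
  then has \<open>w \<le> t Q w\<close>, strictly at \<open>a\<close> unless \<open>w = 0\<close>; pairing with \<open>y\<close> forces \<open>w = 0\<close>, and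
  so \<open>v \<ge> 0\<close>, whence \<open>v\<^sub>a > 0\<close>, a contradiction. Deleting an index therefore raises the least
  real eigenvalue strictly above \<open>1 / r\<close>.
\<close>

section \<open>Eigenvectors of entrywise positive matrices\<close>

lemma pos_row_sum_pos:
  fixes Q :: "'a \<Rightarrow> 'a \<Rightarrow> real"
  assumes "finite S" "\<And>j. j \<in> S \<Longrightarrow> Q i j > 0" "\<And>j. j \<in> S \<Longrightarrow> w j \<ge> 0" "k \<in> S" "w k \<noteq> 0"
  shows "(\<Sum>j\<in>S. Q i j * w j) > 0"
proof -
  have "0 < Q i k * w k"
    using assms(2)[OF assms(4)] assms(3)[OF assms(4)] assms(5) by simp
  also have "\<dots> \<le> (\<Sum>j\<in>S. Q i j * w j)"
    using assms by (intro member_le_sum) (auto intro!: mult_nonneg_nonneg intro: less_imp_le)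
  finally show ?thesis .
qed

text \<open>
  The eigenvector maximises \<open>r\<close> over the compact set of pairs \<open>(r, x)\<close> with \<open>x\<close> in the
  standard simplex and \<open>r x \<le> Q x\<close>: if \<open>Q x \<noteq> r x\<close>, then \<open>z = Q x\<close> satisfies
  \<open>r z < Q z\<close> in every coordinate, and \<open>r\<close> can be increased.
\<close>

theorem positive_matrix_eigenvector:
  fixes Q :: "'a \<Rightarrow> 'a \<Rightarrow> real"
  assumes fin: "finite S" and ne: "S \<noteq> {}"
    and pos: "\<And>i j. i \<in> S \<Longrightarrow> j \<in> S \<Longrightarrow> Q i j > 0"
  obtains r x where "r > 0" "\<And>i. i \<in> S \<Longrightarrow> x i > 0"
    "\<And>i. i \<in> S \<Longrightarrow> (\<Sum>j\<in>S. Q i j * x j) = r * x i"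
proof -
  define C where "C = (\<Sum>i\<in>S. \<Sum>j\<in>S. Q i j)"
  \<comment> \<open>Pinning the coordinates outside \<open>S\<close> to 0 keeps \<open>K\<close>
    compact in the product topology even when the index type is infinite.\<close>
  define K where "K = (PiE UNIV (\<lambda>i. if i \<in> S then {0..1::real} else {0}))"
  define T where "T = ({0..C} \<times> K) \<inter>
    ({p :: real \<times> ('a \<Rightarrow> real). (\<Sum>i\<in>S. snd p i) = 1} \<inter>
      (\<Inter>i\<in>S. {p. fst p * snd p i \<le> (\<Sum>j\<in>S. Q i j * snd p j)}))"
  have T_iff: "(r, x) \<in> T \<longleftrightarrow> 0 \<le> r \<and> r \<le> C \<and> x \<in> K \<and> (\<Sum>i\<in>S. x i) = 1 \<and>
      (\<forall>i\<in>S. r * x i \<le> (\<Sum>j\<in>S. Q i j * x j))" for r x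
    by (auto simp: T_def)
  have K_iff: "x \<in> K \<longleftrightarrow> (\<forall>i. if i \<in> S then 0 \<le> x i \<and> x i \<le> 1 else x i = 0)" for x
    by (simp add: K_def PiE_iff if_distrib[of "\<lambda>s. _ \<in> s"])
  have "compactin (product_topology (\<lambda>_. euclidean) UNIV) K"
    unfolding K_def by (subst compactin_PiE) auto
  then have "compact K" by (simp add: euclidean_product_topology)
  moreover have coord: "continuous_on UNIV (\<lambda>p :: real \<times> ('a \<Rightarrow> real). snd p i)" for i
    by (rule continuous_on_product_then_coordinatewise) (intro continuous_intros)
  have "closed {p :: real \<times> ('a \<Rightarrow> real). (\<Sum>i\<in>S. snd p i) = 1}"
    by (intro closed_Collect_eq continuous_intros coord)
  moreover have "closed {p :: real \<times> ('a \<Rightarrow> real). fst p * snd p i \<le> (\<Sum>j\<in>S. Q i j * snd p j)}" for i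
    by (intro closed_Collect_le continuous_intros coord)
  ultimately have compT: "compact T"
    unfolding T_def by (intro compact_Int_closed compact_Times closed_Int closed_INT) auto
  \<comment> \<open>The cap \<open>C\<close> in \<open>T\<close>, imposed for compactness, cuts
    nothing off: summing \<open>r x \<le> Q x\<close> over the simplex already gives
    \<open>r \<le> C\<close>. So the enlarged value \<open>r + e\<close> below stays within the
    range of the maximisation.\<close>
  have bound: "r \<le> C" if x: "x \<in> K" "(\<Sum>i\<in>S. x i) = 1"
    and le: "\<And>i. i \<in> S \<Longrightarrow> r * x i \<le> (\<Sum>j\<in>S. Q i j * x j)" for r x
  proof -
    have "r = (\<Sum>i\<in>S. r * x i)" using x by (simp flip: sum_distrib_left)
    also have "\<dots> \<le> (\<Sum>i\<in>S. \<Sum>j\<in>S. Q i j * x j)" by (intro sum_mono le)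
    also have "\<dots> \<le> C" unfolding C_def
    proof (intro sum_mono)
      fix i j assume "i \<in> S" "j \<in> S"
      then show "Q i j * x j \<le> Q i j"
        using pos[of i j] x(1) by (auto simp: K_iff intro!: mult_left_le less_imp_le split: if_splits)
    qed
    finally show ?thesis .
  qed
  obtain a where a: "a \<in> S" using ne by auto
  have "(0, \<lambda>i. if i = a then 1 else 0) \<in> T"
    unfolding T_iff using a fin pos
    by (auto simp: K_iff C_def intro!: sum_nonneg mult_nonneg_nonneg intro: less_imp_le)
  then have "T \<noteq> {}" by auto
  moreover have "continuous_on T fst" by (intro continuous_intros)
  ultimately obtain p where "p \<in> T" "\<forall>q\<in>T. fst q \<le> fst p"
    using continuous_attains_sup[OF compT] by blast
  then obtain r x where rx: "(r, x) \<in> T" and max: "\<And>r' x'. (r', x') \<in> T \<Longrightarrow> r' \<le> r"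
    by (cases p) fastforce
  have xK: "x \<in> K" and r0: "r \<ge> 0" and x1: "(\<Sum>i\<in>S. x i) = 1"
    and le: "\<And>i. i \<in> S \<Longrightarrow> r * x i \<le> (\<Sum>j\<in>S. Q i j * x j)"
    using rx by (auto simp: T_iff)
  have x0: "x i \<ge> 0" if "i \<in> S" for i using xK that by (auto simp: K_iff split: if_splits)
  obtain b where b: "b \<in> S" "x b \<noteq> 0" using x1 by (metis sum.neutral zero_neq_one)
  \<comment> \<open>The value 0 outside \<open>S\<close> is what later puts the rescaled vector
    \<open>x'\<close> in \<open>K\<close>.\<close>
  define z where "z i = (if i \<in> S then \<Sum>j\<in>S. Q i j * x j else 0)" for i
  have z_pos: "z i > 0" if "i \<in> S" for i
    using that pos_row_sum_pos[OF fin, of Q i x b] pos x0 b by (simp add: z_def)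
  have eq: "z i = r * x i" if i: "i \<in> S" for i
  proof (rule ccontr)
    assume "z i \<noteq> r * x i"
    then have ni: "z i - r * x i \<noteq> 0" by simp
    have gap: "(\<Sum>j\<in>S. Q k j * z j) - r * z k > 0" if k: "k \<in> S" for k
    proof -
      have "0 < (\<Sum>j\<in>S. Q k j * (z j - r * x j))"
        using fin i ni pos k le
        by (intro pos_row_sum_pos[where i = k and Q = Q and k = i]) (auto simp: z_def)
      also have "\<dots> = (\<Sum>j\<in>S. Q k j * z j) - r * z k"
        using k by (simp add: z_def algebra_simps sum_subtractf sum_distrib_left)
      finally show ?thesis .
    qed
    \<comment> \<open>\<open>g k\<close> is the amount by which \<open>r\<close> can grow before the
      inequality for \<open>z\<close> fails in coordinate \<open>k\<close>; the minimum of these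
      works in all coordinates at once.\<close>
    define g where "g k = ((\<Sum>j\<in>S. Q k j * z j) - r * z k) / z k" for k
    define e where "e = Min (g ` S)"
    have e_pos: "e > 0" using fin ne gap z_pos by (auto simp: e_def g_def)
    have e_le: "e \<le> g k" if "k \<in> S" for k using fin that by (simp add: e_def)
    have le': "(r + e) * z k \<le> (\<Sum>j\<in>S. Q k j * z j)" if k: "k \<in> S" for k
      using e_le[OF k] z_pos[OF k] by (simp add: g_def field_simps)
    define c where "c = (\<Sum>i\<in>S. z i)"
    have c: "c > 0" unfolding c_def using fin ne z_pos by (intro sum_pos) auto
    have zc: "z k \<le> c" if "k \<in> S" for k
      unfolding c_def using that fin z_pos by (intro member_le_sum) (auto intro: less_imp_le)
    define x' where "x' i = z i / c" for i
    have x'K: "x' \<in> K" unfolding K_iff x'_def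
      using c zc z_pos by (auto simp: z_def intro: less_imp_le)
    have x'1: "(\<Sum>i\<in>S. x' i) = 1"
      using c by (simp add: x'_def c_def flip: sum_divide_distrib)
    have x'le: "(r + e) * x' k \<le> (\<Sum>j\<in>S. Q k j * x' j)" if "k \<in> S" for k
      using le'[OF that] c by (simp add: x'_def divide_right_mono flip: sum_divide_distrib)
    have "(r + e, x') \<in> T"
      unfolding T_iff using x'K x'1 x'le bound[OF x'K x'1 x'le] r0 e_pos by simp
    from max[OF this] e_pos show False by simp
  qed
  have "r * x i > 0" if "i \<in> S" for i using eq[OF that] z_pos[OF that] by simp
  then have "r > 0" "\<And>i. i \<in> S \<Longrightarrow> x i > 0"
    using a r0 x0 by (force simp: zero_less_mult_iff)+
  moreover have "(\<Sum>j\<in>S. Q i j * x j) = r * x i" if "i \<in> S" for i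
    using eq[OF that] that by (simp add: z_def)
  ultimately show ?thesis by (rule that)
qed

text \<open>Row \<open>a\<close> of \<open>A v\<close> is left free; its value is the
  \<open>c\<close> of the overview. The case \<open>t * r = 1\<close> is included, and this makes
  the resulting eigenvalue inequality strict. In the application \<open>A\<close> is a principal
  submatrix conjugated by a signature matrix and \<open>v\<close> an eigenvector of the deleted
  matrix extended by 0, so its vanishing is a contradiction.\<close>

lemma no_small_eigenvalue_after_deletion:
  fixes A Q :: "'a \<Rightarrow> 'a \<Rightarrow> real"
  assumes fin: "finite S" and a: "a \<in> S"
    and pos: "\<And>i j. i \<in> S \<Longrightarrow> j \<in> S \<Longrightarrow> Q i j > 0"
    and inv: "\<And>i k. i \<in> S \<Longrightarrow> k \<in> S \<Longrightarrow> (\<Sum>j\<in>S. Q i j * A j k) = (if i = k then 1 else 0)"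
    and y: "\<And>j. j \<in> S \<Longrightarrow> y j > 0"
    and yQ: "\<And>j. j \<in> S \<Longrightarrow> (\<Sum>i\<in>S. y i * Q i j) = r * y j"
    and t: "t > 0" "t * r \<le> 1"
    and va: "v a = 0"
    and v: "\<And>i. i \<in> S - {a} \<Longrightarrow> (\<Sum>j\<in>S. A i j * v j) = t * v i"
    and i: "i \<in> S"
  shows "v i = 0"
proof -
  \<comment> \<open>The sign condition on row \<open>a\<close> costs nothing: \<open>- v\<close>
    satisfies the other hypotheses as well, and one of \<open>v\<close> and \<open>- v\<close>
    satisfies this one.\<close>
  have main: "v i = 0"
    if va: "v a = 0" and v: "\<And>i. i \<in> S - {a} \<Longrightarrow> (\<Sum>j\<in>S. A i j * v j) = t * v i"
      and c: "(\<Sum>j\<in>S. A a j * v j) \<ge> 0" and i: "i \<in> S" for v i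
  proof -
    define c where "c = (\<Sum>j\<in>S. A a j * v j)"
    \<comment> \<open>Apply \<open>Q\<close> to \<open>A v\<close>, which is \<open>t v\<close> off
      \<open>a\<close> and \<open>c\<close> at \<open>a\<close>; the term \<open>t * v a\<close>
      missing there is 0.\<close>
    have v_eq: "v k = t * (\<Sum>j\<in>S. Q k j * v j) + c * Q k a" if k: "k \<in> S" for k
    proof -
      have "v k = (\<Sum>l\<in>S. (if k = l then 1 else 0) * v l)"
        using fin k by (simp add: if_distrib[of "\<lambda>x. x * _"] cong: if_cong)
      also have "\<dots> = (\<Sum>l\<in>S. (\<Sum>j\<in>S. Q k j * A j l) * v l)"
        using inv k by simp
      also have "\<dots> = (\<Sum>j\<in>S. Q k j * (\<Sum>l\<in>S. A j l * v l))"
        by (simp add: sum_distrib_left sum_distrib_right mult.assoc) (rule sum.swap)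
      also have "\<dots> = (\<Sum>j\<in>S. t * (Q k j * v j) + (if j = a then c * Q k a else 0))"
        by (intro sum.cong) (auto simp: v va c_def)
      also have "\<dots> = t * (\<Sum>j\<in>S. Q k j * v j) + c * Q k a"
        using fin a by (simp add: sum.distrib sum_distrib_left)
      finally show ?thesis .
    qed
    define w where "w k = max 0 (- v k)" for k
    have w_le: "w k \<le> t * (\<Sum>j\<in>S. Q k j * w j)" if k: "k \<in> S" for k
    proof -
      have nn: "0 \<le> (\<Sum>j\<in>S. Q k j * w j)"
        using pos[OF k] by (intro sum_nonneg) (auto simp: w_def intro!: mult_nonneg_nonneg intro: less_imp_le)
      have "(\<Sum>j\<in>S. Q k j * (- w j)) \<le> (\<Sum>j\<in>S. Q k j * v j)"
        using pos[OF k] by (intro sum_mono mult_left_mono) (auto simp: w_def less_imp_le)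
      then have "t * - (\<Sum>j\<in>S. Q k j * w j) \<le> t * (\<Sum>j\<in>S. Q k j * v j)"
        using t(1) by (intro mult_left_mono) (auto simp: sum_negf)
      moreover have "0 \<le> c * Q k a" using c pos[OF k a] by (simp add: c_def)
      ultimately have "- v k \<le> t * (\<Sum>j\<in>S. Q k j * w j)" using v_eq[OF k] by simp
      then show ?thesis using nn t by (simp add: w_def)
    qed
    have w_zero: "w k = 0" if k: "k \<in> S" for k
    proof (rule ccontr)
      assume wk: "w k \<noteq> 0"
      have w0: "w j \<ge> 0" for j by (simp add: w_def)
      \<comment> \<open>The left side is 0 because \<open>v a = 0\<close>, while a positive row
        applied to a nonzero nonnegative vector is positive.\<close>
      have strict: "w a < t * (\<Sum>j\<in>S. Q a j * w j)"
        using pos_row_sum_pos[OF fin, of Q a w k] pos a w0 k wk t va by (simp add: w_def)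
      have "(\<Sum>i\<in>S. y i * w i) < (\<Sum>i\<in>S. y i * (t * (\<Sum>j\<in>S. Q i j * w j)))"
        using fin a strict w_le y
        by (intro sum_strict_mono_ex1) (auto intro!: mult_left_mono less_imp_le[OF y] bexI[of _ a])
      also have "\<dots> = t * (\<Sum>j\<in>S. (\<Sum>i\<in>S. y i * Q i j) * w j)"
        by (simp add: sum_distrib_left sum_distrib_right mult_ac) (rule sum.swap)
      also have "\<dots> = t * r * (\<Sum>j\<in>S. y j * w j)"
        using yQ by (simp add: sum_distrib_left mult_ac)
      also have "\<dots> \<le> 1 * (\<Sum>j\<in>S. y j * w j)"
        using t y w0 by (intro mult_right_mono sum_nonneg mult_nonneg_nonneg) (auto intro: less_imp_le)
      finally show False by simp
    qed
    have v0: "v k \<ge> 0" if "k \<in> S" for k using w_zero[OF that] by (simp add: w_def max_def split: if_splits)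
    show "v i = 0"
    proof (rule ccontr)
      assume "v i \<noteq> 0"
      \<comment> \<open>Now \<open>v\<close> is nonnegative and nonzero, so the equation for
        coordinate \<open>a\<close> would make \<open>v a\<close> positive.\<close>
      then have "0 < t * (\<Sum>j\<in>S. Q a j * v j)"
        using pos_row_sum_pos[OF fin, of Q a v i] pos a v0 i t by simp
      moreover have "0 \<le> c * Q a a" using c pos[OF a a] by (simp add: c_def)
      ultimately show False using v_eq[OF a] va by simp
    qed
  qed
  show ?thesis
  proof (cases "(\<Sum>j\<in>S. A a j * v j) \<ge> 0")
    case True
    then show ?thesis using main[of v] va v i by blast
  next
    case False
    have "- v i = 0"
    proof (rule main[of "\<lambda>k. - v k"])
      show "(\<Sum>j\<in>S. A k j * - v j) = t * - v k" if "k \<in> S - {a}" for k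
        using v[OF that] by (simp add: sum_negf)
    qed (use va i False in \<open>simp_all add: sum_negf\<close>)
    then show ?thesis by simp
  qed
qed

section \<open>Principal submatrices\<close>

lemma pick_eqI:
  assumes "x \<in> S" "card {a \<in> S. a < x} = p"
  shows "pick S p = x"
  using pick_card_in_set[OF assms(1)] assms(2) by simp

lemma pick_delete_lessThan:
  assumes "i < m" "p < m - 1"
  shows "pick ({..<m} - {i}) p = (if p < i then p else Suc p)"
proof (rule pick_eqI)
  have "{a \<in> {..<m} - {i}. a < (if p < i then p else Suc p)} =
      (if p < i then {..<p} else {..<Suc p} - {i})" using assms by auto
  then show "card {a \<in> {..<m} - {i}. a < (if p < i then p else Suc p)} = p"
    by (simp add: card_Diff_singleton)
qed (use assms in auto)

text \<open>Elements after the removed one move down by one position. This is the index shift built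
  into \<open>mat_delete\<close>.\<close>

lemma pick_delete:
  assumes fin: "finite S" and i: "i < card S" and p: "p < card S - 1"
  shows "pick (S - {pick S i}) p = pick S (if p < i then p else Suc p)"
proof (rule pick_eqI)
  let ?q = "if p < i then p else Suc p"
  have q: "?q < card S" "?q \<noteq> i" using i p by auto
  have mono: "pick S i < pick S ?q \<longleftrightarrow> i < ?q"
    using pick_mono_le[of ?q S i] pick_mono_le[of i S ?q] i q by (metis linorder_neqE_nat order.asym)
  have "pick S ?q \<noteq> pick S i"
    using card_pick_le[OF q(1)] card_pick_le[OF i] q(2) by metis
  then show "pick S ?q \<in> S - {pick S i}" using pick_in_set_le[OF q(1)] by auto
  have "{a \<in> S - {pick S i}. a < pick S ?q} = {a \<in> S. a < pick S ?q} - {pick S i}" by auto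
  moreover have "pick S i \<in> {a \<in> S. a < pick S ?q} \<longleftrightarrow> i < ?q"
    using mono pick_in_set_le[OF i] by simp
  ultimately show "card {a \<in> S - {pick S i}. a < pick S ?q} = p"
    using card_pick_le[OF q(1)] fin by (cases "p < i") (auto simp: card_Diff_singleton_if)
qed

text \<open>Index sets of size \<open>m - 1\<close> are complements of single indices, so this turns
  the entries of the \<open>(m - 1)\<close>th compound into the minors that occur in
  cofactors.\<close>

lemma submatrix_eq_mat_delete:
  assumes M: "M \<in> carrier_mat m m" and "i < m" "k < m"
  shows "submatrix M ({..<m} - {i}) ({..<m} - {k}) = mat_delete M i k"
proof -
  have c: "card {a. a < m \<and> a \<in> {..<m} - {i}} = m - 1" if "i < m" for i
  proof -
    have "{a. a < m \<and> a \<in> {..<m} - {i}} = {..<m} - {i}" by auto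
    then show ?thesis using that by simp
  qed
  show ?thesis
    unfolding submatrix_def mat_delete_def using assms
    by (intro eq_matI) (auto simp: c[OF assms(2)] c[OF assms(3)] pick_delete_lessThan simp del: Diff_iff lessThan_iff)
qed

context
  fixes n :: nat and A :: "real mat" and \<alpha> :: "nat set"
  assumes A: "A \<in> carrier_mat n n" and \<alpha>: "\<alpha> \<subseteq> {..<n}"
begin

lemma card_Collect_lt_mem: "card {a. a < n \<and> a \<in> \<alpha>} = card \<alpha>"
  using \<alpha> by (intro arg_cong[of _ _ card]) auto

lemma principal_submatrix_carrier [simp]:
  "principal_submatrix A \<alpha> \<in> carrier_mat (card \<alpha>) (card \<alpha>)"
  using A by (simp add: principal_submatrix_def submatrix_def card_Collect_lt_mem)

lemma principal_submatrix_index: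
  "i < card \<alpha> \<Longrightarrow> j < card \<alpha> \<Longrightarrow> principal_submatrix A \<alpha> $$ (i, j) = A $$ (pick \<alpha> i, pick \<alpha> j)"
  using A by (simp add: principal_submatrix_def submatrix_index card_Collect_lt_mem)

lemma bij_betw_pick: "bij_betw (pick \<alpha>) {..<card \<alpha>} \<alpha>"
proof (rule bij_betwI[where g = "\<lambda>i. card {a \<in> \<alpha>. a < i}"])
  have fin: "finite \<alpha>" using \<alpha> finite_subset by blast
  show "(\<lambda>i. card {a \<in> \<alpha>. a < i}) \<in> \<alpha> \<rightarrow> {..<card \<alpha>}"
    using fin by (auto intro!: psubset_card_mono)
qed (auto simp: pick_in_set_le card_pick_le pick_card_in_set)

lemma position_lt_card: "i \<in> \<alpha> \<Longrightarrow> card {a \<in> \<alpha>. a < i} < card \<alpha>"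
  using finite_subset[OF \<alpha>] by (auto intro!: psubset_card_mono)

lemma sum_pick: "(\<Sum>j<card \<alpha>. f (pick \<alpha> j)) = (\<Sum>j\<in>\<alpha>. f j :: real)"
  by (rule sum.reindex_bij_betw[OF bij_betw_pick])

lemma mat_delete_principal_submatrix:
  assumes i: "i < card \<alpha>"
  shows "mat_delete (principal_submatrix A \<alpha>) i i = principal_submatrix A (\<alpha> - {pick \<alpha> i})"
proof -
  have fin: "finite \<alpha>" using \<alpha> finite_subset by blast
  have c: "card {a. a < n \<and> a \<in> \<alpha> - {pick \<alpha> i}} = card \<alpha> - 1"
  proof -
    have "{a. a < n \<and> a \<in> \<alpha> - {pick \<alpha> i}} = \<alpha> - {pick \<alpha> i}" using \<alpha> by auto
    then show ?thesis using pick_in_set_le[OF i] fin by simp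
  qed
  have d: "dim_row (principal_submatrix A \<alpha>) = card \<alpha>" "dim_col (principal_submatrix A \<alpha>) = card \<alpha>"
    using carrier_matD[OF principal_submatrix_carrier] by auto
  have e: "principal_submatrix A (\<alpha> - {pick \<alpha> i}) = mat (card \<alpha> - 1) (card \<alpha> - 1)
      (\<lambda>(p, q). A $$ (pick (\<alpha> - {pick \<alpha> i}) p, pick (\<alpha> - {pick \<alpha> i}) q))"
    unfolding principal_submatrix_def submatrix_def using A c by simp
  show ?thesis
    unfolding mat_delete_def d e
    by (intro eq_matI) (auto simp: principal_submatrix_index pick_delete[OF fin i])
qed

text \<open>Indexing eigenvectors by \<alpha> itself rather than by positions lets vectors for
  \<alpha> and for \<alpha> with an index removed be compared directly, with extension by 0.\<close>

lemma eigenvalue_principal_submatrix_iff: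
  "eigenvalue (principal_submatrix A \<alpha>) t \<longleftrightarrow>
    (\<exists>v. (\<exists>i\<in>\<alpha>. v i \<noteq> 0) \<and> (\<forall>i\<in>\<alpha>. (\<Sum>j\<in>\<alpha>. A $$ (i, j) * v j) = t * v i))"
    (is "?L \<longleftrightarrow> ?R")
proof
  let ?M = "principal_submatrix A \<alpha>" let ?m = "card \<alpha>"
  have d: "dim_row ?M = ?m" "dim_col ?M = ?m" using carrier_matD[OF principal_submatrix_carrier] by auto
  {
    assume ?L
    then obtain w where w: "w \<in> carrier_vec ?m" "w \<noteq> 0\<^sub>v ?m" "?M *\<^sub>v w = t \<cdot>\<^sub>v w"
      by (auto simp: eigenvalue_def eigenvector_def d)
    \<comment> \<open>The number of smaller elements of \<alpha> is the position of
      \<open>i\<close>, so this inverts \<open>pick\<close>.\<close>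
    define v where "v i = w $ (card {a \<in> \<alpha>. a < i})" for i
    have v_pick: "v (pick \<alpha> i) = w $ i" if "i < ?m" for i using that by (simp add: v_def card_pick_le)
    obtain k where k: "k < ?m" "w $ k \<noteq> 0" using w by (metis eq_vecI carrier_vecD index_zero_vec)
    have "(\<Sum>j\<in>\<alpha>. A $$ (i, j) * v j) = t * v i" if i: "i \<in> \<alpha>" for i
    proof -
      define p where "p = card {a \<in> \<alpha>. a < i}"
      have p: "p < ?m" "pick \<alpha> p = i" using i by (auto simp: p_def position_lt_card pick_card_in_set)
      have "(\<Sum>j\<in>\<alpha>. A $$ (i, j) * v j) = (\<Sum>j<?m. A $$ (i, pick \<alpha> j) * v (pick \<alpha> j))"
        by (rule sum_pick[symmetric])
      also have "\<dots> = (\<Sum>j<?m. ?M $$ (p, j) * w $ j)"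
        using p by (intro sum.cong) (auto simp: v_pick principal_submatrix_index)
      also have "\<dots> = (?M *\<^sub>v w) $ p"
        using p w(1) d by (auto simp: scalar_prod_def lessThan_atLeast0 intro!: sum.cong)
      also have "\<dots> = t * v i" using p w by (simp add: v_def p_def[symmetric])
      finally show ?thesis .
    qed
    moreover have "\<exists>i\<in>\<alpha>. v i \<noteq> 0" using k v_pick pick_in_set_le by metis
    ultimately show ?R by blast
  }
  assume ?R
  then obtain v k where v: "k \<in> \<alpha>" "v k \<noteq> 0" "\<And>i. i \<in> \<alpha> \<Longrightarrow> (\<Sum>j\<in>\<alpha>. A $$ (i, j) * v j) = t * v i"
    by blast
  define w where "w = vec ?m (\<lambda>i. v (pick \<alpha> i))"
  have "w $ (card {a \<in> \<alpha>. a < k}) \<noteq> 0"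
    using v(1,2) by (simp add: w_def position_lt_card pick_card_in_set)
  then have "w \<noteq> 0\<^sub>v ?m" using position_lt_card[OF v(1)] by auto
  moreover have "?M *\<^sub>v w = t \<cdot>\<^sub>v w"
  proof (rule eq_vecI)
    fix i assume "i < dim_vec (t \<cdot>\<^sub>v w)"
    then have i: "i < ?m" by (simp add: w_def)
    have "(?M *\<^sub>v w) $ i = (\<Sum>j<?m. A $$ (pick \<alpha> i, pick \<alpha> j) * v (pick \<alpha> j))"
      using i d by (auto simp: scalar_prod_def lessThan_atLeast0 w_def principal_submatrix_index intro!: sum.cong)
    also have "\<dots> = (\<Sum>j\<in>\<alpha>. A $$ (pick \<alpha> i, j) * v j)" by (rule sum_pick)
    also have "\<dots> = (t \<cdot>\<^sub>v w) $ i" using i by (simp add: v(3) pick_in_set_le w_def)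
    finally show "(?M *\<^sub>v w) $ i = (t \<cdot>\<^sub>v w) $ i" .
  qed (simp add: d w_def)
  moreover have "w \<in> carrier_vec ?m" by (simp add: w_def)
  ultimately show ?L by (auto simp: eigenvalue_def eigenvector_def d)
qed

end

lemma principal_submatrix_transpose:
  assumes "A \<in> carrier_mat n n" "\<alpha> \<subseteq> {..<n}"
  shows "principal_submatrix (transpose_mat A) \<alpha> = transpose_mat (principal_submatrix A \<alpha>)"
proof -
  have A': "transpose_mat A \<in> carrier_mat n n" using assms(1) by simp
  have "pick \<alpha> i < n" if "i < card \<alpha>" for i using pick_in_set_le[OF that] assms(2) by auto
  then show ?thesis
    using principal_submatrix_carrier[OF assms] principal_submatrix_carrier[OF A' assms(2)] assms(1)
    by (intro eq_matI) (auto simp: principal_submatrix_index[OF assms] principal_submatrix_index[OF A' assms(2)])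
qed

lemma principal_submatrix_full:
  assumes "A \<in> carrier_mat n n"
  shows "principal_submatrix A {..<n} = A"
proof -
  have "pick {..<n} i = i" if "i < n" for i
  proof (rule pick_eqI)
    have "{a \<in> {..<n}. a < i} = {..<i}" using that by auto
    then show "card {a \<in> {..<n}. a < i} = i" by simp
  qed (use that in simp)
  then show ?thesis
    using assms principal_submatrix_carrier[OF assms order_refl]
    by (intro eq_matI) (auto simp: principal_submatrix_index[OF assms order_refl])
qed

section \<open>Real spectrum and real eigenvalues\<close>

lemma real_spectrum_iff:
  assumes "M \<in> carrier_mat m m"
  shows "x \<in> real_spectrum M \<longleftrightarrow> eigenvalue M x"
proof -
  have "map_mat complex_of_real M \<in> carrier_mat m m" using assms by simp
  then show ?thesis
    by (simp add: real_spectrum_def spectrum_def eigenvalue_root_char_poly[OF assms]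
        eigenvalue_root_char_poly of_real_hom.char_poly_hom[OF assms])
qed

lemma eigenvalue_transpose:
  assumes "(M :: real mat) \<in> carrier_mat m m"
  shows "eigenvalue (transpose_mat M) x \<longleftrightarrow> eigenvalue M x"
  using assms by (simp add: eigenvalue_root_char_poly[of _ m])

section \<open>Matrices with positive principal minors\<close>

text \<open>Expand along row \<open>i\<close>: its cofactors do not see the changed entry.\<close>

lemma det_add_diagonal_entry:
  assumes M: "M \<in> carrier_mat m m" and M': "M' \<in> carrier_mat m m" and i: "i < m"
    and eq: "\<And>p q. p < m \<Longrightarrow> q < m \<Longrightarrow> M' $$ (p, q) = M $$ (p, q) + (if p = i \<and> q = i then s else 0)"
  shows "det M' = det M + s * det (mat_delete M i i :: real mat)"
proof -
  have del: "mat_delete M' i j = mat_delete M i j" if "j < m" for j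
    unfolding mat_delete_def using M M' i that by (intro eq_matI) (auto simp: eq)
  have "det M' = (\<Sum>j<m. M' $$ (i, j) * cofactor M' i j)"
    by (rule laplace_expansion_row[OF M' i])
  also have "\<dots> = (\<Sum>j<m. M $$ (i, j) * cofactor M i j + (if j = i then s * cofactor M i j else 0))"
    by (intro sum.cong) (auto simp: cofactor_def del eq i algebra_simps)
  also have "\<dots> = det M + s * cofactor M i i"
    using i by (simp add: sum.distrib laplace_expansion_row[OF M i])
  also have "cofactor M i i = det (mat_delete M i i)"
    by (simp add: cofactor_def mult_2[symmetric])
  finally show ?thesis .
qed

text \<open>The empty index set is included and contributes determinant 1; removing the index of a
  singleton leads there.\<close>

definition P_matrix :: "nat \<Rightarrow> real mat \<Rightarrow> bool" where
  "P_matrix n A \<longleftrightarrow> A \<in> carrier_mat n n \<and> (\<forall>\<alpha> \<subseteq> {..<n}. det (principal_submatrix A \<alpha>) > 0)"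

text \<open>Changing the diagonal entries one at a time makes induction on \<open>k\<close>
  possible: each change adds to a principal minor containing that index \<open>s\<close> times a
  smaller principal minor, which is positive by induction.\<close>

lemma P_matrix_add_diagonal:
  assumes "P_matrix n A" "s \<ge> 0"
  shows "P_matrix n (mat n n (\<lambda>(i, j). A $$ (i, j) + (if i = j \<and> i < k then s else 0)))"
proof (induction k)
  case 0
  have "mat n n (\<lambda>(i, j). A $$ (i, j) + (if i = j \<and> i < 0 then s else 0)) = A"
    using assms(1) by (intro eq_matI) (auto simp: P_matrix_def)
  then show ?case using assms(1) by simp
next
  case (Suc k)
  define B where "B = mat n n (\<lambda>(i, j). A $$ (i, j) + (if i = j \<and> i < k then s else 0))"
  define B' where "B' = mat n n (\<lambda>(i, j). A $$ (i, j) + (if i = j \<and> i < Suc k then s else 0))"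
  have B: "B \<in> carrier_mat n n" and B': "B' \<in> carrier_mat n n" by (auto simp: B_def B'_def)
  have BB': "B' $$ (i, j) = B $$ (i, j) + (if i = k \<and> j = k then s else 0)" if "i < n" "j < n" for i j
    using that by (auto simp: B_def B'_def)
  have detB: "det (principal_submatrix B \<alpha>) > 0" if "\<alpha> \<subseteq> {..<n}" for \<alpha>
    using Suc.IH that by (simp add: P_matrix_def B_def)
  have "det (principal_submatrix B' \<alpha>) > 0" if \<alpha>: "\<alpha> \<subseteq> {..<n}" for \<alpha>
  proof -
    let ?m = "card \<alpha>"
    have lt: "pick \<alpha> i < n" "pick \<alpha> i \<in> \<alpha>" if "i < ?m" for i
      using pick_in_set_le[OF that] \<alpha> by auto
    show ?thesis
    proof (cases "k \<in> \<alpha>")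
      case True
      define i where "i = card {a \<in> \<alpha>. a < k}"
      have i: "i < ?m" "pick \<alpha> i = k"
        using True by (auto simp: i_def position_lt_card[OF B \<alpha>] pick_card_in_set)
      have "pick \<alpha> p = k \<longleftrightarrow> p = i" if "p < ?m" for p
        using card_pick_le[OF that] i by (auto simp: i_def)
      then have "det (principal_submatrix B' \<alpha>) =
          det (principal_submatrix B \<alpha>) + s * det (mat_delete (principal_submatrix B \<alpha>) i i)"
        using B B' \<alpha> i lt BB'
        by (intro det_add_diagonal_entry[where m = ?m])
          (auto simp: principal_submatrix_index[OF B \<alpha>] principal_submatrix_index[OF B' \<alpha>])
      also have "mat_delete (principal_submatrix B \<alpha>) i i = principal_submatrix B (\<alpha> - {k})"
        using mat_delete_principal_submatrix[OF B \<alpha> i(1)] i by simp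
      finally show ?thesis
        using detB[OF \<alpha>] detB[of "\<alpha> - {k}"] \<alpha> assms(2) by (auto intro!: add_pos_nonneg mult_nonneg_nonneg intro: less_imp_le)
    next
      case False
      have "principal_submatrix B' \<alpha> = principal_submatrix B \<alpha>"
        using principal_submatrix_carrier[OF B \<alpha>] principal_submatrix_carrier[OF B' \<alpha>] lt False BB'
        by (intro eq_matI)
          (auto simp: principal_submatrix_index[OF B \<alpha>] principal_submatrix_index[OF B' \<alpha>])
      then show ?thesis using detB[OF \<alpha>] by simp
    qed
  qed
  then show ?case using B' by (simp add: P_matrix_def B'_def)
qed

text \<open>For \<open>t \<le> 0\<close> the matrix \<open>A - t I\<close> again has positive
  principal minors, so the characteristic matrix at \<open>t\<close> cannot be singular.\<close>

lemma P_matrix_eigenvalue_pos: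
  assumes P: "P_matrix n A" and \<alpha>: "\<alpha> \<subseteq> {..<n}"
    and ev: "eigenvalue (principal_submatrix A \<alpha>) t"
  shows "t > 0"
proof (rule ccontr)
  assume t: "\<not> t > 0"
  have A: "A \<in> carrier_mat n n" using P by (simp add: P_matrix_def)
  define B where "B = mat n n (\<lambda>(i, j). A $$ (i, j) + (if i = j \<and> i < n then - t else 0))"
  have "P_matrix n B" unfolding B_def using P t by (intro P_matrix_add_diagonal) auto
  then have B: "B \<in> carrier_mat n n" and "det (principal_submatrix B \<alpha>) > 0"
    using \<alpha> by (auto simp: P_matrix_def)
  moreover have "principal_submatrix B \<alpha> = char_matrix (principal_submatrix A \<alpha>) t"
  proof -
    have lt: "pick \<alpha> i < n" if "i < card \<alpha>" for i
      using pick_in_set_le[OF that] \<alpha> by auto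
    have inj: "pick \<alpha> i = pick \<alpha> j \<longleftrightarrow> i = j" if "i < card \<alpha>" "j < card \<alpha>" for i j
      using card_pick_le[OF that(1)] card_pick_le[OF that(2)] by metis
    have BA: "B $$ (i, j) = A $$ (i, j) - (if i = j then t else 0)" if "i < n" "j < n" for i j
      using that by (simp add: B_def)
    show ?thesis
      using principal_submatrix_carrier[OF A \<alpha>] principal_submatrix_carrier[OF B \<alpha>] lt inj BA
      by (intro eq_matI)
        (auto simp: char_matrix_def principal_submatrix_index[OF A \<alpha>] principal_submatrix_index[OF B \<alpha>])
  qed
  ultimately show False
    using ev eigenvalue_det[OF principal_submatrix_carrier[OF A \<alpha>]] by simp
qed

section \<open>SJSK matrices\<close>

text \<open>The set \<open>J\<close> lives on lexicographic positions of
  \<open>(m - 1)\<close>-subsets. Each such subset omits exactly one index, so \<open>J\<close>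
  becomes a sign for each deleted index.\<close>

lemma SJS_compound_minor_signs:
  assumes M: "M \<in> carrier_mat m m" and m: "m \<ge> 1"
    and sjs: "strictly_J_sign_symmetric (compound_matrix (m - 1) M)"
  obtains s :: "nat \<Rightarrow> real" where "\<And>i. s i * s i = 1"
    "\<And>i k. i < m \<Longrightarrow> k < m \<Longrightarrow> s i * s k * det (mat_delete M i k) > 0"
proof -
  define R where "R = lex_subsets m (m - 1)"
  define C where "C = compound_matrix (m - 1) M"
  have C: "C = mat (length R) (length R) (\<lambda>(a, b). det (submatrix M (set (R ! a)) (set (R ! b))))"
    using M by (simp add: C_def compound_matrix_def R_def Let_def)
  \<comment> \<open>This yields \<open>f\<close>, the lexicographic position of the complement of
    \<open>i\<close>.\<close>
  have "\<exists>a<length R. set (R ! a) = {..<m} - {i}" if "i < m" for i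
  proof -
    have "{..<m} - {i} \<in> set ` set R"
      using bij_betw_lex_subsets[of m "m - 1"] that by (auto simp: bij_betw_def R_def)
    then show ?thesis by (auto simp: in_set_conv_nth)
  qed
  then obtain f where f: "\<And>i. i < m \<Longrightarrow> f i < length R" "\<And>i. i < m \<Longrightarrow> set (R ! f i) = {..<m} - {i}"
    by metis
  have entry: "C $$ (f i, f k) = det (mat_delete M i k)" if "i < m" "k < m" for i k
    using that f submatrix_eq_mat_delete[OF M that] by (simp add: C)
  have "dim_row C = length R" by (simp add: C)
  then obtain J where
      J_pos: "\<forall>(i, j) \<in> (J \<times> J) \<union> (({..<length R} - J) \<times> ({..<length R} - J)). C $$ (i, j) > 0" and
      J_neg: "\<forall>(i, j) \<in> (J \<times> ({..<length R} - J)) \<union> (({..<length R} - J) \<times> J). C $$ (i, j) < 0"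
    using sjs unfolding strictly_J_sign_symmetric_def C_def[symmetric] Let_def by metis
  have J: "if i \<in> J \<longleftrightarrow> j \<in> J then C $$ (i, j) > 0 else C $$ (i, j) < 0"
    if "i < length R" "j < length R" for i j
    using bspec[OF J_pos, of "(i, j)"] bspec[OF J_neg, of "(i, j)"] that by auto
  define s where "s i = (if f i \<in> J then 1 else - 1 :: real)" for i
  show ?thesis
  proof (rule that[of s])
    fix i k assume ik: "i < m" "k < m"
    show "s i * s k * det (mat_delete M i k) > 0"
      using J[OF f(1)[OF ik(1)] f(1)[OF ik(2)]] entry[OF ik] by (auto simp: s_def split: if_splits)
  qed (simp add: s_def)
qed

context
  fixes n :: nat and A :: "real mat"
  assumes A: "A \<in> carrier_mat n n" and sjsk: "SJSK A"
begin

lemma SJSK_minor_signs: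
  assumes \<alpha>: "\<alpha> \<subseteq> {..<n}" "\<alpha> \<noteq> {}"
  obtains s :: "nat \<Rightarrow> real" where "\<And>i. s i * s i = 1"
    "\<And>i k. i < card \<alpha> \<Longrightarrow> k < card \<alpha> \<Longrightarrow> s i * s k * det (mat_delete (principal_submatrix A \<alpha>) i k) > 0"
proof (cases "card \<alpha> \<ge> 2")
  case True
  have "card \<alpha> \<le> n" using card_mono[OF _ \<alpha>(1)] by simp
  then have "strictly_J_sign_symmetric (compound_matrix (card \<alpha> - 1) (principal_submatrix A \<alpha>))"
    using sjsk A \<alpha> True by (auto simp: SJSK_def)
  from SJS_compound_minor_signs[OF principal_submatrix_carrier[OF A \<alpha>(1)] _ this] True that
  show ?thesis by auto
next
  \<comment> \<open>The compound condition starts at order 2. For a singleton the minor is the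
    determinant of an empty matrix, so constant signs work.\<close>
  case False
  then have "card \<alpha> = 1" using \<alpha> finite_subset[OF \<alpha>(1)] by (cases "card \<alpha>") auto
  then have "mat_delete (principal_submatrix A \<alpha>) i k \<in> carrier_mat 0 0" for i k
    using mat_delete_carrier[OF principal_submatrix_carrier[OF A \<alpha>(1)]] by simp
  then have "det (mat_delete (principal_submatrix A \<alpha>) i k) = 1" for i k
    by (rule det_dim_zero)
  then show ?thesis using that[of "\<lambda>_. 1"] by simp
qed

text \<open>A proper principal minor on \<beta> is a diagonal minor of the set \<beta> with one
  index added, where the two signs cancel; the full minor is positive by definition.\<close>

lemma SJSK_imp_P_matrix: "P_matrix n A"
proof -
  have "det (principal_submatrix A \<beta>) > 0" if \<beta>: "\<beta> \<subseteq> {..<n}" for \<beta>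
  proof (cases "\<beta> = {..<n}")
    case True
    then show ?thesis using sjsk principal_submatrix_full[OF A] by (simp add: SJSK_def)
  next
    case False
    then obtain a where a: "a < n" "a \<notin> \<beta>" using \<beta> by auto
    define \<alpha> where "\<alpha> = insert a \<beta>"
    have \<alpha>: "\<alpha> \<subseteq> {..<n}" "\<alpha> \<noteq> {}" using a \<beta> by (auto simp: \<alpha>_def)
    define i where "i = card {b \<in> \<alpha>. b < a}"
    have i: "i < card \<alpha>" "pick \<alpha> i = a"
      using position_lt_card[OF A \<alpha>(1), of a] pick_card_in_set[of a \<alpha>] by (simp_all add: i_def \<alpha>_def)
    obtain s :: "nat \<Rightarrow> real" where s: "s i * s i = 1"
      "s i * s i * det (mat_delete (principal_submatrix A \<alpha>) i i) > 0"
      using SJSK_minor_signs[OF \<alpha>] i(1) by metis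
    then show ?thesis
      using mat_delete_principal_submatrix[OF A \<alpha>(1) i(1)] i(2) a by (simp add: \<alpha>_def)
  qed
  then show ?thesis using A by (simp add: P_matrix_def)
qed

text \<open>
  Cramer's rule turns the minor signs into the statement that the inverse of a principal
  submatrix is positive after conjugation with a signature matrix \<open>D\<close>.
\<close>

lemma SJSK_positive_inverse:
  assumes \<alpha>: "\<alpha> \<subseteq> {..<n}" "\<alpha> \<noteq> {}"
  obtains D :: "nat \<Rightarrow> real" and Q where "\<And>i. D i * D i = 1"
    "\<And>i j. i \<in> \<alpha> \<Longrightarrow> j \<in> \<alpha> \<Longrightarrow> Q i j > 0"
    "\<And>i k. i \<in> \<alpha> \<Longrightarrow> k \<in> \<alpha> \<Longrightarrow>
      (\<Sum>j\<in>\<alpha>. Q i j * (D j * A $$ (j, k) * D k)) = (if i = k then 1 else 0)"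
proof -
  let ?m = "card \<alpha>" let ?M = "principal_submatrix A \<alpha>"
  have M: "?M \<in> carrier_mat ?m ?m" by (rule principal_submatrix_carrier[OF A \<alpha>(1)])
  have det: "det ?M > 0" using SJSK_imp_P_matrix \<alpha> by (simp add: P_matrix_def)
  obtain s :: "nat \<Rightarrow> real" where s: "\<And>i. s i * s i = 1"
    "\<And>i k. i < ?m \<Longrightarrow> k < ?m \<Longrightarrow> s i * s k * det (mat_delete ?M i k) > 0"
    by (rule SJSK_minor_signs[OF \<alpha>], blast)
  \<comment> \<open>The sign from the compound is combined with the checkerboard sign, so that the
    factors of -1 in the cofactors cancel in \<open>adj_pos\<close>.\<close>
  define d where "d i = (- 1) ^ i * s i" for i
  define pos where "pos i = card {a \<in> \<alpha>. a < i}" for i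
  have pos: "pos i < ?m" "pick \<alpha> (pos i) = i" if "i \<in> \<alpha>" for i
    using that position_lt_card[OF A \<alpha>(1)] by (auto simp: pos_def pick_card_in_set)
  have pos_pick: "pos (pick \<alpha> i) = i" if "i < ?m" for i
    using that by (simp add: pos_def card_pick_le)
  have dd: "d i * d i = 1" for i
    using s(1)[of i] by (simp add: d_def mult.assoc mult.left_commute flip: power_add mult_2)
  have adj_pos: "d i * adj_mat ?M $$ (i, k) * d k > 0" if "i < ?m" "k < ?m" for i k
  proof -
    have "(- 1 :: real) ^ i * (- 1) ^ k * (- 1) ^ (k + i) = 1"
      by (simp flip: power_add add: add.commute[of k] mult_2[symmetric])
    then have "d i * adj_mat ?M $$ (i, k) * d k = s k * s i * det (mat_delete ?M k i)"
      using that M by (simp add: adj_mat_def cofactor_def d_def algebra_simps power_add)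
    then show ?thesis using s(2)[OF that(2,1)] by simp
  qed
  \<comment> \<open>These are the entries of the conjugated inverse, with the inverse written as
    adjugate over determinant.\<close>
  define Q where "Q i j = d (pos i) * adj_mat ?M $$ (pos i, pos j) * d (pos j) / det ?M" for i j
  show ?thesis
  proof (rule that[of "\<lambda>i. d (pos i)" Q])
    fix i j assume ij: "i \<in> \<alpha>" "j \<in> \<alpha>"
    show "Q i j > 0" using adj_pos[OF pos(1)[OF ij(1)] pos(1)[OF ij(2)]] det by (simp add: Q_def)
  next
    fix i k assume i: "i \<in> \<alpha>" and k: "k \<in> \<alpha>"
    have "(\<Sum>j\<in>\<alpha>. Q i j * (d (pos j) * A $$ (j, k) * d (pos k))) =
        (\<Sum>j<?m. Q i (pick \<alpha> j) * (d (pos (pick \<alpha> j)) * A $$ (pick \<alpha> j, k) * d (pos k)))"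
      by (rule sum_pick[OF A \<alpha>(1), symmetric])
    also have "\<dots> = (\<Sum>j<?m. d (pos i) * d (pos k) / det ?M * (adj_mat ?M $$ (pos i, j) * ?M $$ (j, pos k)))"
    proof (intro sum.cong refl)
      fix j assume "j \<in> {..<?m}"
      then have j: "j < ?m" by simp
      have "Q i (pick \<alpha> j) * (d (pos (pick \<alpha> j)) * A $$ (pick \<alpha> j, k) * d (pos k)) =
        (d j * d j) * (d (pos i) * d (pos k) / det ?M * (adj_mat ?M $$ (pos i, j) * ?M $$ (j, pos k)))"
        using j pos[OF k] by (simp add: Q_def pos_pick principal_submatrix_index[OF A \<alpha>(1)] ac_simps)
      then show "Q i (pick \<alpha> j) * (d (pos (pick \<alpha> j)) * A $$ (pick \<alpha> j, k) * d (pos k)) =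
        d (pos i) * d (pos k) / det ?M * (adj_mat ?M $$ (pos i, j) * ?M $$ (j, pos k))"
        by (simp add: dd)
    qed
    also have "\<dots> = d (pos i) * d (pos k) / det ?M * (adj_mat ?M * ?M) $$ (pos i, pos k)"
      using adj_mat(1)[OF M] M pos(1)[OF i] pos(1)[OF k]
      by (auto simp: scalar_prod_def lessThan_atLeast0 sum_distrib_left intro!: sum.cong)
    also have "\<dots> = (if i = k then 1 else 0)"
    proof -
      have "pos i = pos k \<longleftrightarrow> i = k" using pos(2)[OF i] pos(2)[OF k] by metis
      then show ?thesis using adj_mat(3)[OF M] pos(1)[OF i] pos(1)[OF k] det dd by auto
    qed
    finally show "(\<Sum>j\<in>\<alpha>. Q i j * (d (pos j) * A $$ (j, k) * d (pos k))) = (if i = k then 1 else 0)" .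
  qed (rule dd)
qed

text \<open>The witness is \<open>l = 1 / r\<close> from the overview. Lying below every eigenvalue
  of each deletion is enough for the comparison, since the least eigenvalue on \<alpha> is at most
  \<open>l\<close>.\<close>

lemma SJSK_eigenvalue_below_deletions:
  assumes \<alpha>: "\<alpha> \<subseteq> {..<n}" "\<alpha> \<noteq> {}"
  obtains l where "eigenvalue (principal_submatrix A \<alpha>) l"
    "\<And>a t. a \<in> \<alpha> \<Longrightarrow> eigenvalue (principal_submatrix A (\<alpha> - {a})) t \<Longrightarrow> l < t"
proof -
  have fin: "finite \<alpha>" using \<alpha> finite_subset by blast
  obtain D Q where D: "\<And>i. D i * D i = (1 :: real)"
    and Q: "\<And>i j. i \<in> \<alpha> \<Longrightarrow> j \<in> \<alpha> \<Longrightarrow> Q i j > 0"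
    and inv: "\<And>i k. i \<in> \<alpha> \<Longrightarrow> k \<in> \<alpha> \<Longrightarrow>
      (\<Sum>j\<in>\<alpha>. Q i j * (D j * A $$ (j, k) * D k)) = (if i = k then 1 else 0)"
    by (rule SJSK_positive_inverse[OF \<alpha>], blast)
  obtain r y where r: "r > 0" and y: "\<And>i. i \<in> \<alpha> \<Longrightarrow> y i > 0"
    and yQ: "\<And>j. j \<in> \<alpha> \<Longrightarrow> (\<Sum>i\<in>\<alpha>. Q i j * y i) = r * y j"
    \<comment> \<open>The matrix is passed in transposed, so \<open>y\<close> is a left eigenvector
      of \<open>Q\<close>.\<close>
    by (rule positive_matrix_eigenvector[of \<alpha> "\<lambda>i j. Q j i"]) (use fin \<alpha>(2) Q in blast)+
  have D0: "D i \<noteq> 0" for i using D[of i] by auto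
  have AT: "transpose_mat A \<in> carrier_mat n n" using A by simp
  \<comment> \<open>Multiplying \<open>y Q = r y\<close> on the right by \<open>D A D\<close>, which
    \<open>Q\<close> inverts on \<alpha>, gives \<open>y = r y (D A D)\<close>. Hence
    \<open>D y\<close> is a left eigenvector of the principal submatrix with eigenvalue
    \<open>1 / r\<close>, which is why the transpose appears below.\<close>
  have "(\<Sum>i\<in>\<alpha>. A $$ (i, k) * (D i * y i)) = 1 / r * (D k * y k)" if k: "k \<in> \<alpha>" for k
  proof -
    have "r * (\<Sum>j\<in>\<alpha>. y j * (D j * A $$ (j, k) * D k)) = (\<Sum>j\<in>\<alpha>. (r * y j) * (D j * A $$ (j, k) * D k))"
      by (simp only: sum_distrib_left mult.assoc)
    also have "\<dots> = (\<Sum>j\<in>\<alpha>. (\<Sum>i\<in>\<alpha>. Q i j * y i) * (D j * A $$ (j, k) * D k))"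
      by (intro sum.cong) (simp_all only: yQ)
    also have "\<dots> = (\<Sum>j\<in>\<alpha>. \<Sum>i\<in>\<alpha>. y i * (Q i j * (D j * A $$ (j, k) * D k)))"
      unfolding sum_distrib_right by (intro sum.cong refl) (simp only: mult_ac)
    also have "\<dots> = (\<Sum>i\<in>\<alpha>. y i * (\<Sum>j\<in>\<alpha>. Q i j * (D j * A $$ (j, k) * D k)))"
      by (subst sum.swap) (simp add: sum_distrib_left)
    also have "\<dots> = (\<Sum>i\<in>\<alpha>. y i * (if i = k then 1 else 0))"
      using inv k by simp
    also have "\<dots> = y k" using fin k by (simp add: if_distrib[of "(*) (y _)"] cong: if_cong)
    finally have "D k * (r * (\<Sum>j\<in>\<alpha>. y j * (D j * A $$ (j, k) * D k))) = D k * y k" by simp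
    moreover have "D k * (r * (\<Sum>j\<in>\<alpha>. y j * (D j * A $$ (j, k) * D k))) =
        D k * D k * (r * (\<Sum>i\<in>\<alpha>. A $$ (i, k) * (D i * y i)))"
      by (simp add: sum_distrib_left ac_simps)
    ultimately have "r * (\<Sum>i\<in>\<alpha>. A $$ (i, k) * (D i * y i)) = D k * y k"
      by (simp only: D mult_1)
    then have "(\<Sum>i\<in>\<alpha>. A $$ (i, k) * (D i * y i)) = D k * y k / r"
      using r by (simp add: eq_divide_eq mult.commute)
    then show ?thesis by simp
  qed
  moreover have "\<exists>i\<in>\<alpha>. D i * y i \<noteq> 0" using \<alpha>(2) y D0 by force
  ultimately have "eigenvalue (principal_submatrix (transpose_mat A) \<alpha>) (1 / r)"
    unfolding eigenvalue_principal_submatrix_iff[OF AT \<alpha>(1)]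
    using A \<alpha>(1) by (intro exI[of _ "\<lambda>i. D i * y i"]) (auto simp: subset_iff cong: sum.cong)
  then have ev: "eigenvalue (principal_submatrix A \<alpha>) (1 / r)"
    using eigenvalue_transpose[OF principal_submatrix_carrier[OF A \<alpha>(1)]]
      principal_submatrix_transpose[OF A \<alpha>(1)] by simp
  have "1 / r < t" if a: "a \<in> \<alpha>" and t: "eigenvalue (principal_submatrix A (\<alpha> - {a})) t" for a t
  proof (rule ccontr)
    assume "\<not> 1 / r < t"
    then have tr: "t * r \<le> 1" using r by (simp add: field_simps)
    have sub: "\<alpha> - {a} \<subseteq> {..<n}" using \<alpha> by auto
    have t0: "t > 0" using P_matrix_eigenvalue_pos[OF SJSK_imp_P_matrix sub t] .
    obtain v k where v: "k \<in> \<alpha> - {a}" "v k \<noteq> 0"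
      "\<And>i. i \<in> \<alpha> - {a} \<Longrightarrow> (\<Sum>j\<in>\<alpha> - {a}. A $$ (i, j) * v j) = t * v i"
      using t eigenvalue_principal_submatrix_iff[OF A sub] by blast
    \<comment> \<open>Conjugating by \<open>D\<close> passes to the matrix inverted by
      \<open>Q\<close>; the zero at \<open>a\<close> means that column \<open>a\<close> contributes
      nothing to the sums.\<close>
    define u where "u i = (if i = a then 0 else D i * v i)" for i
    have u: "(\<Sum>j\<in>\<alpha>. D i * A $$ (i, j) * D j * u j) = t * u i" if i: "i \<in> \<alpha> - {a}" for i
    proof -
      have "(\<Sum>j\<in>\<alpha>. D i * A $$ (i, j) * D j * u j) = (\<Sum>j\<in>\<alpha> - {a}. D i * A $$ (i, j) * D j * u j)"
        using fin a by (simp add: sum.remove[of \<alpha> a] u_def)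
      also have "\<dots> = (\<Sum>j\<in>\<alpha> - {a}. (D j * D j) * (D i * (A $$ (i, j) * v j)))"
        by (intro sum.cong) (auto simp: u_def)
      also have "\<dots> = D i * (\<Sum>j\<in>\<alpha> - {a}. A $$ (i, j) * v j)"
        by (simp add: D sum_distrib_left)
      also have "\<dots> = t * u i" using i v(3) by (simp add: u_def)
      finally show ?thesis .
    qed
    have yQ': "(\<Sum>i\<in>\<alpha>. y i * Q i j) = r * y j" if "j \<in> \<alpha>" for j
      using yQ[OF that] by (simp only: mult.commute)
    have ua: "u a = 0" by (simp add: u_def)
    have k: "k \<in> \<alpha>" using v(1) by blast
    have "u k = 0"
      by (rule no_small_eigenvalue_after_deletion[where S = \<alpha> and a = a and Q = Q and y = y
            and r = r and t = t and A = "\<lambda>i j. D i * A $$ (i, j) * D j"])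
        ((assumption | rule fin a Q inv y yQ' t0 tr ua u k)+)
    then show False using v(1,2) D0[of k] by (simp add: u_def)
  qed
  with ev show ?thesis by (rule that)
qed

section \<open>Least real eigenvalues of the principal submatrices\<close>

lemma SJSK_min_real_eigenvalue:
  assumes \<alpha>: "\<alpha> \<subseteq> {..<n}" "\<alpha> \<noteq> {}"
  obtains l where "min_real_eigenvalue (principal_submatrix A \<alpha>) = ereal l"
    "eigenvalue (principal_submatrix A \<alpha>) l"
    "\<And>t. eigenvalue (principal_submatrix A \<alpha>) t \<Longrightarrow> l \<le> t"
proof -
  let ?M = "principal_submatrix A \<alpha>"
  have M: "?M \<in> carrier_mat (card \<alpha>) (card \<alpha>)" by (rule principal_submatrix_carrier[OF A \<alpha>(1)])
  obtain l where "eigenvalue ?M l" by (rule SJSK_eigenvalue_below_deletions[OF \<alpha>])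
  then have "real_spectrum ?M \<noteq> {}" using real_spectrum_iff[OF M] by auto
  then show ?thesis
    using that[of "Min (real_spectrum ?M)"] finite_real_spectrum[OF M] Min_in[of "real_spectrum ?M"]
      real_spectrum_iff[OF M] by (simp add: min_real_eigenvalue_def)
qed

text \<open>Remove the indices outside \<beta> one at a time; every single removal raises the value
  strictly, and the inequalities chain.\<close>

lemma SJSK_min_real_eigenvalue_strict:
  assumes "\<beta> \<noteq> {}" "\<beta> \<subset> \<alpha>" "\<alpha> \<subseteq> {..<n}"
  shows "min_real_eigenvalue (principal_submatrix A \<alpha>) < min_real_eigenvalue (principal_submatrix A \<beta>)"
proof -
  let ?l = "\<lambda>\<alpha>. min_real_eigenvalue (principal_submatrix A \<alpha>)"
  have step: "?l \<alpha> < ?l (\<alpha> - {a})" if \<alpha>: "\<alpha> \<subseteq> {..<n}" "a \<in> \<alpha>" "\<alpha> - {a} \<noteq> {}" for \<alpha> a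
  proof -
    have ne: "\<alpha> \<noteq> {}" and sub: "\<alpha> - {a} \<subseteq> {..<n}" using \<alpha> by auto
    obtain l where l: "eigenvalue (principal_submatrix A \<alpha>) l"
      "\<And>a t. a \<in> \<alpha> \<Longrightarrow> eigenvalue (principal_submatrix A (\<alpha> - {a})) t \<Longrightarrow> l < t"
      by (rule SJSK_eigenvalue_below_deletions[OF \<alpha>(1) ne], blast)
    obtain l1 where l1: "?l \<alpha> = ereal l1" "\<And>t. eigenvalue (principal_submatrix A \<alpha>) t \<Longrightarrow> l1 \<le> t"
      by (rule SJSK_min_real_eigenvalue[OF \<alpha>(1) ne], blast)
    obtain l2 where l2: "?l (\<alpha> - {a}) = ereal l2" "eigenvalue (principal_submatrix A (\<alpha> - {a})) l2"
      by (rule SJSK_min_real_eigenvalue[OF sub \<alpha>(3)], blast)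
    show ?thesis using l1(1) l1(2)[OF l(1)] l2(1) l(2)[OF \<alpha>(2) l2(2)] by simp
  qed
  have "finite \<alpha>" using assms(3) finite_subset by blast
  then show ?thesis using assms
  proof (induction \<alpha> rule: finite_psubset_induct)
    case (psubset \<alpha>)
    then obtain a where a: "a \<in> \<alpha>" "a \<notin> \<beta>" by auto
    then have \<beta>: "\<beta> \<subseteq> \<alpha> - {a}" using psubset.prems by auto
    then have *: "?l \<alpha> < ?l (\<alpha> - {a})" using psubset.prems a by (intro step) auto
    show ?case
    proof (cases "\<beta> = \<alpha> - {a}")
      case False
      then have "?l (\<alpha> - {a}) < ?l \<beta>" using a \<beta> psubset.prems by (intro psubset.IH) auto
      with * show ?thesis by (rule less_trans)
    qed (use * in simp)
  qed
qed

end

theorem theorem8: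
  fixes n :: nat and A :: "real mat"
  assumes "n \<ge> 1" and "A \<in> carrier_mat n n" and "SJSK A"
  shows "strictly_tau_matrix A"
proof -
  note A = assms(2,3)
  have "{..<n} \<noteq> {}" using assms(1) by (auto simp: lessThan_empty_iff)
  then obtain l where l: "min_real_eigenvalue A = ereal l" "eigenvalue A l"
    using SJSK_min_real_eigenvalue[OF A order_refl] principal_submatrix_full[OF A(1)] by metis
  then have "l > 0"
    using P_matrix_eigenvalue_pos[OF SJSK_imp_P_matrix[OF A] order_refl]
      principal_submatrix_full[OF A(1)] by simp
  then have pos: "min_real_eigenvalue A > 0" using l by simp
  have fin: "min_real_eigenvalue (principal_submatrix A \<beta>) < \<infinity>" if "\<beta> \<subseteq> {..<n}" "\<beta> \<noteq> {}" for \<beta>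
    using SJSK_min_real_eigenvalue[OF A that] by (metis less_ereal.simps(4))
  have strict: "\<forall>\<alpha> \<beta>. \<beta> \<noteq> {} \<and> \<beta> \<subset> \<alpha> \<and> \<alpha> \<subseteq> {..<n} \<longrightarrow>
      min_real_eigenvalue (principal_submatrix A \<alpha>) < min_real_eigenvalue (principal_submatrix A \<beta>)"
    using SJSK_min_real_eigenvalue_strict[OF A] by blast
  have mono: "\<forall>\<alpha> \<beta>. \<beta> \<noteq> {} \<and> \<beta> \<subseteq> \<alpha> \<and> \<alpha> \<subseteq> {..<n} \<longrightarrow>
      min_real_eigenvalue (principal_submatrix A \<alpha>) \<le> min_real_eigenvalue (principal_submatrix A \<beta>) \<and>
      min_real_eigenvalue (principal_submatrix A \<beta>) < \<infinity>"
    using strict fin by (metis order.trans order_le_less psubset_eq)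
  have "square_mat A" and dim: "dim_row A = n" using A(1) by auto
  then show ?thesis
    unfolding strictly_tau_matrix_def tau_matrix_def dim
    by (intro conjI less_imp_le pos mono strict)
qed

end
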